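(* Let $\mathcal{X}$ be a finite non-empty set and let $\overline{T}\colon\mathbb{R}^{\mathcal{X}}\to\mathbb{R}^{\mathcal{X}}$ be a finitely generated upper transition operator. Let $d$, $\mathcal{X}_{\mathrm{t}\triangledown}^{\ell}$ and $\mathcal{X}_{\mathrm{m},1}^{\ell},\dots,\mathcal{X}_{\mathrm{m},M_\ell}^{\ell}$ be as in the repeated decomposition of $\mathcal{X}$ described in the context. If $\overline{T}$ is convergent, then for all $\ell\in\{1,\dots,d\}$ the maximal communication classes $\mathcal{X}_{\mathrm{m},1}^{\ell},\dots,\mathcal{X}_{\mathrm{m},M_\ell}^{\ell}$ of $\overline{T}_{\mathcal{X}_{\mathrm{t}\triangledown}^{\ell-1}}$ are regular for $\overline{T}_{\mathcal{X}_{\mathrm{t}\triangledown}^{\ell-1}}$.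
   Context: The following definitions apply to any finite non-empty state space $\mathcal{Y}$ (in particular to $\mathcal{X}$ and its non-empty subsets). $\mathbb{N}=\{1,2,\dots\}$; order on functions is pointwise; constants are identified with constant functions; $\mathbb{1}_A$ is the indicator of $A$ and $\mathbb{1}_y=\mathbb{1}_{\{y\}}$. Upper transition operator on $\mathcal{Y}$: a map $\overline{T}\colon\mathbb{R}^{\mathcal{Y}}\to\mathbb{R}^{\mathcal{Y}}$ with $\overline{T}(f+g)\le\overline{T}f+\overline{T}g$, $\overline{T}(\lambda f)=\lambda\overline{T}f$ for real $\lambda\ge0$, and $\overline{T}f\le\max f$. Its conjugate lower transition operator is $\underline{T}f:=-\overline{T}(-f)$. $\overline{T}$ is convergent if $(\overline{T}^nf)_{n\in\mathbb{N}}$ converges for all $f\in\mathbb{R}^{\mathcal{Y}}$. $\overline{T}$ is finitely generated if there are finite non-empty sets $\mathcal{P}^x$ ($x\in\mathcal{Y}$) of probability mass functions on $\mathcal{Y}$ with $\overline{T}f(x)=\max\{\sum_yp(y)f(y)\colon p\in\mathcal{P}^x\}$ for all $f\in\mathbb{R}^{\mathcal{Y}}$ and $x\in\mathcal{Y}$. Graph notions: the upper accessibility graph of $\overline{T}$ has node set $\mathcal{Y}$ and a directed edge from $x$ to $y$ iff $\overline{T}\mathbb{1}_y(x)>0$. $y$ is accessible from $x$ if $y=x$ or there is a directed path from $x$ to $y$. Two states communicate if each is accessible from the other; the equivalence classes are the communication classes. A communication class is maximal if no state outside it is accessible from a state in it. A maximal communication class $C$ is regular (for $\overline{T}$) if the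 greatest common divisor of the lengths of the closed directed paths staying in $C$ is $1$; equivalently, if there is $N\in\mathbb{N}$ with $\overline{T}^n\mathbb{1}_y(x)>0$ for all $n\ge N$ and $x,y\in C$. A non-empty set $C\subseteq\mathcal{Y}$ is lower reachable from $x$ if $\underline{T}^n\mathbb{1}_C(x)>0$ for some $n\in\mathbb{N}$. Restriction: for $x\in\mathcal{Y}$, the credal set $\mathcal{Q}^x$ is the set of probability mass functions $p$ on $\mathcal{Y}$ with $\sum_y p(y)f(y)\le\overline{T}f(x)$ for all $f\in\mathbb{R}^{\mathcal{Y}}$. For non-empty $C\subseteq\mathcal{Y}$ and $x\in C$, $\mathcal{Q}^x_C:=\{p|_C\colon p\in\mathcal{Q}^x,\ p(y)=0\text{ for all }y\in\mathcal{Y}\setminus C\}$. If $\mathcal{Q}_C^x\neq\emptyset$ for all $x\in C$, the restricted operator $\overline{T}_C\colon\mathbb{R}^C\to\mathbb{R}^C$ is well defined: $\overline{T}_Cg(x):=\max\{\sum_{y\in C}q(y)g(y)\colon q\in\mathcal{Q}^x_C\}$; it is an upper transition operator on $C$. Repeated decomposition: set $\mathcal{X}_{\mathrm{t}\triangledown}^0:=\mathcal{X}$ and $\overline{T}_{\mathcal{X}_{\mathrm{t}\triangledown}^0}:=\overline{T}$. For $\ell=1,2,\dots$, as long as $\mathcal{X}_{\mathrm{t}\triangledown}^{\ell-1}\neq\emptyset$: let $\mathcal{X}_{\mathrm{m},1}^\ell,\dots,\mathcal{X}_{\mathrm{m},M_\ell}^\ell$ be the maximal communication classes of the upper transition operator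 $\overline{T}_{\mathcal{X}_{\mathrm{t}\triangledown}^{\ell-1}}$ on state space $\mathcal{X}_{\mathrm{t}\triangledown}^{\ell-1}$, let $\mathcal{X}_{\mathrm{m}}^\ell$ be their union, let $\mathcal{X}_{\mathrm{t}\blacktriangledown}^\ell$ (respectively $\mathcal{X}_{\mathrm{t}\triangledown}^\ell$) be the set of states in $\mathcal{X}_{\mathrm{t}\triangledown}^{\ell-1}\setminus\mathcal{X}_{\mathrm{m}}^\ell$ from which $\mathcal{X}_{\mathrm{m}}^\ell$ is (respectively is not) lower reachable with respect to $\overline{T}_{\mathcal{X}_{\mathrm{t}\triangledown}^{\ell-1}}$; if $\mathcal{X}_{\mathrm{t}\triangledown}^\ell\ne\emptyset$, restrict $\overline{T}_{\mathcal{X}_{\mathrm{t}\triangledown}^{\ell-1}}$ to $\mathcal{X}_{\mathrm{t}\triangledown}^\ell$ (this restriction is always well defined and equals $\overline{T}_{\mathcal{X}_{\mathrm{t}\triangledown}^{\ell}}$, the direct restriction of $\overline{T}$) and continue. $d$ is the first $\ell\ge1$ with $\mathcal{X}_{\mathrm{t}\triangledown}^\ell=\emptyset$. *)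

theory Defs
  imports "HOL-Probability.Probability_Mass_Function"
begin

text \<open>
  A state space is a finite non-empty set \<open>Y :: 'a set\<close>. An element of \<open>\<real>\<^sup>Y\<close> is represented by any
  total function \<open>'a \<Rightarrow> real\<close> with the given values on \<open>Y\<close>, and an operator on \<open>\<real>\<^sup>Y\<close> by a map on total
  functions of which only the values at points of \<open>Y\<close> matter. Every condition below is imposed at points
  of \<open>Y\<close> only; the result at such a point does not depend on the values of the argument outside \<open>Y\<close>
  (lemma \<open>upper_transition_operator_cong\<close>).
\<close>

type_synonym 'a operator = "('a \<Rightarrow> real) \<Rightarrow> 'a \<Rightarrow> real"

definition upper_transition_operator :: "'a set \<Rightarrow> 'a operator \<Rightarrow> bool" where
  "upper_transition_operator Y T \<longleftrightarrow>
     (\<forall>f g. \<forall>x\<in>Y. T (\<lambda>y. f y + g y) x \<le> T f x + T g x) \<and>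
     (\<forall>c f. c \<ge> 0 \<longrightarrow> (\<forall>x\<in>Y. T (\<lambda>y. c * f y) x = c * T f x)) \<and>
     (\<forall>f. \<forall>x\<in>Y. T f x \<le> Max (f ` Y))"

definition lower_operator :: "'a operator \<Rightarrow> 'a operator" where
  "lower_operator T = (\<lambda>f x. - T (\<lambda>y. - f y) x)"

definition convergent_operator :: "'a set \<Rightarrow> 'a operator \<Rightarrow> bool" where
  "convergent_operator Y T \<longleftrightarrow> (\<forall>f. \<forall>x\<in>Y. convergent (\<lambda>n. (T ^^ n) f x))"

text \<open>Probability mass functions on \<open>Y\<close> are the \<open>p :: 'a pmf\<close> with \<open>set_pmf p \<subseteq> Y\<close>.\<close>

definition finitely_generated :: "'a set \<Rightarrow> 'a operator \<Rightarrow> bool" where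
  "finitely_generated Y T \<longleftrightarrow>
     (\<exists>P :: 'a \<Rightarrow> 'a pmf set.
        (\<forall>x\<in>Y. finite (P x) \<and> P x \<noteq> {} \<and> (\<forall>p\<in>P x. set_pmf p \<subseteq> Y)) \<and>
        (\<forall>f. \<forall>x\<in>Y. T f x = Max ((\<lambda>p. \<Sum>y\<in>Y. pmf p y * f y) ` P x)))"

definition accessibility_graph :: "'a set \<Rightarrow> 'a operator \<Rightarrow> ('a \<times> 'a) set" where
  "accessibility_graph Y T = {(x, y). x \<in> Y \<and> y \<in> Y \<and> T (indicator {y}) x > 0}"

definition accessible :: "'a set \<Rightarrow> 'a operator \<Rightarrow> 'a \<Rightarrow> 'a \<Rightarrow> bool" where
  "accessible Y T x y \<longleftrightarrow> (x, y) \<in> (accessibility_graph Y T)\<^sup>*"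

definition communication_relation :: "'a set \<Rightarrow> 'a operator \<Rightarrow> ('a \<times> 'a) set" where
  "communication_relation Y T =
     {(x, y). x \<in> Y \<and> y \<in> Y \<and> accessible Y T x y \<and> accessible Y T y x}"

definition communication_classes :: "'a set \<Rightarrow> 'a operator \<Rightarrow> 'a set set" where
  "communication_classes Y T = Y // communication_relation Y T"

definition maximal_classes :: "'a set \<Rightarrow> 'a operator \<Rightarrow> 'a set set" where
  "maximal_classes Y T =
     {C \<in> communication_classes Y T. \<forall>x\<in>C. \<forall>y\<in>Y - C. \<not> accessible Y T x y}"

definition regular_class :: "'a set \<Rightarrow> 'a operator \<Rightarrow> 'a set \<Rightarrow> bool" where
  "regular_class Y T C \<longleftrightarrow>
     C \<in> maximal_classes Y T \<and>
     Gcd {n::nat. n \<ge> 1 \<and> (\<exists>x\<in>C. (x, x) \<in> (accessibility_graph Y T \<inter> C \<times> C) ^^ n)} = 1"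

definition lower_reachable :: "'a operator \<Rightarrow> 'a set \<Rightarrow> 'a \<Rightarrow> bool" where
  "lower_reachable T C x \<longleftrightarrow> (\<exists>n\<ge>1. (lower_operator T ^^ n) (indicator C) x > 0)"

definition credal_set :: "'a set \<Rightarrow> 'a operator \<Rightarrow> 'a \<Rightarrow> 'a pmf set" where
  "credal_set Y T x =
     {p. set_pmf p \<subseteq> Y \<and> (\<forall>f. (\<Sum>y\<in>Y. pmf p y * f y) \<le> T f x)}"

text \<open>
  A mass function vanishing outside \<open>C\<close> and its restriction to \<open>C\<close> are the same \<open>'a pmf\<close>. The credal set
  is compact, so for \<open>x \<in> C\<close> the supremum in \<open>restricted_operator\<close> is a maximum as soon as
  \<open>restricted_credal_set Y T C x\<close> is non-empty.
\<close>

definition restricted_credal_set :: "'a set \<Rightarrow> 'a operator \<Rightarrow> 'a set \<Rightarrow> 'a \<Rightarrow> 'a pmf set" where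
  "restricted_credal_set Y T C x = {p \<in> credal_set Y T x. \<forall>y\<in>Y - C. pmf p y = 0}"

definition restricted_operator :: "'a set \<Rightarrow> 'a operator \<Rightarrow> 'a set \<Rightarrow> 'a operator" where
  "restricted_operator Y T C =
     (\<lambda>g x. SUP q\<in>restricted_credal_set Y T C x. \<Sum>y\<in>C. pmf q y * g y)"

definition remaining_states :: "'a set \<Rightarrow> 'a operator \<Rightarrow> 'a set" where
  "remaining_states Y T =
     {x \<in> Y - \<Union>(maximal_classes Y T). \<not> lower_reachable T (\<Union>(maximal_classes Y T)) x}"

text \<open>
  Stage \<open>l\<close> of the repeated decomposition: the set left after \<open>l\<close> steps, with the operator restricted to
  it. Once this set is empty it stays empty, and the operator component is then meaningless.
\<close>

primrec decomposition :: "'a set \<Rightarrow> 'a operator \<Rightarrow> nat \<Rightarrow> 'a set \<times> 'a operator" where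
  "decomposition X T 0 = (X, T)"
| "decomposition X T (Suc l) =
     (let (Y, S) = decomposition X T l; Y' = remaining_states Y S
      in (Y', restricted_operator Y S Y'))"

definition stage_states :: "'a set \<Rightarrow> 'a operator \<Rightarrow> nat \<Rightarrow> 'a set" where
  "stage_states X T l = fst (decomposition X T l)"

definition stage_operator :: "'a set \<Rightarrow> 'a operator \<Rightarrow> nat \<Rightarrow> 'a operator" where
  "stage_operator X T l = snd (decomposition X T l)"

definition decomposition_depth :: "'a set \<Rightarrow> 'a operator \<Rightarrow> nat" where
  "decomposition_depth X T = (LEAST l. l \<ge> 1 \<and> stage_states X T l = {})"

lemma upper_transition_operator_cong:
  assumes "upper_transition_operator Y T" "finite Y" "x \<in> Y" "\<And>y. y \<in> Y \<Longrightarrow> f y = g y"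
  shows "T f x = T g x"
proof -
  have le: "T h x \<le> T k x" if "\<And>y. y \<in> Y \<Longrightarrow> h y = k y" for h k
  proof -
    have im: "(\<lambda>y. h y - k y) ` Y = {0}"
      using that assms(3) by (auto simp: image_iff)
    have sub: "\<And>f g. T (\<lambda>y. f y + g y) x \<le> T f x + T g x"
      and max: "\<And>f. T f x \<le> Max (f ` Y)"
      using assms(1,3) by (simp_all add: upper_transition_operator_def)
    have "T (\<lambda>y. (h y - k y) + k y) x \<le> T (\<lambda>y. h y - k y) x + T k x"
      by (rule sub)
    moreover have "T (\<lambda>y. h y - k y) x \<le> Max ((\<lambda>y. h y - k y) ` Y)"
      by (rule max)
    ultimately show ?thesis by (simp add: im)
  qed
  show ?thesis using le[of f g] le[of g f] assms(4) by force
qed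

text \<open>The minimum defining \<open>decomposition_depth\<close> exists.\<close>

lemma maximal_classes_nonempty:
  assumes "finite Y" "Y \<noteq> {}"
  shows "Y \<inter> \<Union>(maximal_classes Y T) \<noteq> {}"
proof -
  define R where "R x = {y \<in> Y. accessible Y T x y}" for x
  obtain x where x: "x \<in> Y" and min: "\<And>z. z \<in> Y \<Longrightarrow> card (R x) \<le> card (R z)"
    using ex_has_least_nat[of "\<lambda>x. x \<in> Y" _ "\<lambda>x. card (R x)"] assms(2) by blast
  define C where "C = communication_relation Y T `` {x}"
  have R_eq: "R z = R x" if "z \<in> R x" for z
  proof (rule card_seteq)
    show "finite (R x)" using assms(1) by (simp add: R_def)
    show "R z \<subseteq> R x" using that by (auto simp: R_def accessible_def)
    show "card (R x) \<le> card (R z)" using that min by (simp add: R_def)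
  qed
  have C: "C = R x"
  proof
    show "C \<subseteq> R x" by (auto simp: C_def communication_relation_def R_def)
    have xR: "x \<in> R x" using x by (simp add: R_def accessible_def)
    show "R x \<subseteq> C"
    proof
      fix y assume y: "y \<in> R x"
      then have "x \<in> R y" using R_eq xR by blast
      then show "y \<in> C" using x y by (auto simp: C_def communication_relation_def R_def)
    qed
  qed
  have "C \<in> maximal_classes Y T"
    unfolding maximal_classes_def communication_classes_def
  proof (intro CollectI conjI ballI)
    show "C \<in> Y // communication_relation Y T"
      using x by (simp add: C_def quotientI)
    fix z y assume "z \<in> C" "y \<in> Y - C"
    then show "\<not> accessible Y T z y" using R_eq[of z] C by (auto simp: R_def)
  qed
  moreover have "x \<in> C" using C x by (simp add: R_def accessible_def)
  ultimately show ?thesis using x by blast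
qed

lemma decomposition_terminates:
  assumes "finite X"
  shows "\<exists>l\<ge>1. stage_states X T l = {}"
proof -
  have step: "stage_states X T (Suc l) = remaining_states (stage_states X T l) (stage_operator X T l)" for l
    by (simp add: stage_states_def stage_operator_def Let_def split: prod.split)
  have fin: "finite (stage_states X T l)" for l
  proof (induction l)
    case 0
    then show ?case using assms by (simp add: stage_states_def)
  next
    case (Suc l)
    then show ?case unfolding step by (auto simp: remaining_states_def)
  qed
  have less: "card (stage_states X T (Suc l)) < card (stage_states X T l)"
    if "stage_states X T l \<noteq> {}" for l
    unfolding step using maximal_classes_nonempty[OF fin that]
    by (intro psubset_card_mono fin) (auto simp: remaining_states_def)
  have "stage_states X T l = {} \<or> card (stage_states X T l) + l \<le> card X" for l
  proof (induction l)
    case 0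
    then show ?case by (simp add: stage_states_def)
  next
    case (Suc l)
    show ?case
    proof (cases "stage_states X T l = {}")
      case True
      then show ?thesis by (simp add: step remaining_states_def)
    next
      case False
      then show ?thesis using Suc less[OF False] by linarith
    qed
  qed
  from this[of "Suc (card X)"] show ?thesis by (intro exI[of _ "Suc (card X)"]) auto
qed

end

theory Submission
  imports Defs
begin

text \<open>
  Being finitely generated and convergent is inherited by the operator \<open>S\<close> restricted to the remaining
  states \<open>Y'\<close>, so it suffices to treat a maximal class \<open>C\<close> of a convergent finitely generated operator.

  If the cycle lengths in \<open>C\<close> have greatest common divisor \<open>D\<close>, let \<open>A\<close> be the cyclic class of a state
  \<open>x \<in> C\<close>. Every generating mass function at a state of \<open>C\<close> moves all its mass to the next cyclic class, so
  \<open>T\<^sup>n 1\<^sub>A x\<close> is \<open>1\<close> if \<open>D\<close> divides \<open>n\<close> and \<open>0\<close> otherwise, and convergence forces \<open>D = 1\<close>.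

  For the inheritance, the \<open>n\<close>-th iterate \<open>w\<close> of the lower operator on the indicator of the union of the
  maximal classes satisfies, for large \<open>n\<close>, that \<open>w = 0\<close> on \<open>Y'\<close>, \<open>w > 0\<close> off \<open>Y'\<close> and \<open>T (c - K w) \<le> c - K w\<close>
  for constants \<open>c\<close> and \<open>K \<ge> 0\<close>. By finite generation, leaving \<open>Y'\<close> has a cost bounded away from \<open>0\<close>, so for
  large \<open>K\<close> the iterates \<open>T\<^sup>n (g - K w)\<close> and \<open>S\<^sup>n g\<close> agree on \<open>Y'\<close>.
\<close>

section \<open>Averages under mass functions, and uniform penalty constants\<close>

text \<open>Each ratio \<open>\<bar>c\<bar> / m p\<close> is at most the sum of all of them, which
  serves as \<open>K\<close>. It supplies a single penalty factor for all generators that leave a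
  given set.\<close>

lemma finite_uniform_multiplier:
  fixes m :: "'b \<Rightarrow> real"
  assumes "finite F" and "\<And>p. p \<in> F \<Longrightarrow> 0 < m p"
  shows "\<exists>K\<ge>0. \<forall>p\<in>F. c \<le> K * m p"
proof -
  define K where "K = (\<Sum>p\<in>F. \<bar>c\<bar> / m p)"
  have nonneg: "0 \<le> \<bar>c\<bar> / m p" if "p \<in> F" for p
    using assms(2)[OF that] by simp
  have "c \<le> K * m p" if p: "p \<in> F" for p
  proof -
    have "\<bar>c\<bar> / m p \<le> K"
      unfolding K_def using p nonneg by (intro member_le_sum assms(1)) auto
    then show ?thesis using assms(2)[OF p] by (simp add: field_simps)
  qed
  moreover have "0 \<le> K" unfolding K_def by (intro sum_nonneg nonneg)
  ultimately show ?thesis by blast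
qed

lemma sum_pmf_mult_cong:
  assumes "\<And>y. y \<in> set_pmf p \<Longrightarrow> f y = g y"
  shows "(\<Sum>y\<in>Y. pmf p y * f y) = (\<Sum>y\<in>Y. pmf p y * g y)"
  using assms by (intro sum.cong refl) (auto simp: set_pmf_iff)

lemma sum_pmf_mult_mono_set:
  fixes f :: "'a \<Rightarrow> real"
  assumes "finite Y" "Y' \<subseteq> Y" "set_pmf p \<subseteq> Y'"
  shows "(\<Sum>y\<in>Y. pmf p y * f y) = (\<Sum>y\<in>Y'. pmf p y * f y)"
  using assms by (intro sum.mono_neutral_right) (auto simp: set_pmf_iff)

lemma sum_pmf_mult_const:
  assumes "finite Y" "set_pmf p \<subseteq> Y"
  shows "(\<Sum>y\<in>Y. pmf p y * c) = c"
  using sum_pmf_eq_1[OF assms] by (simp add: sum_distrib_right[symmetric])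

lemma sum_pmf_mult_pos:
  fixes f :: "'a \<Rightarrow> real"
  assumes "finite Y" "set_pmf p \<subseteq> Y" "\<And>y. y \<in> Y \<Longrightarrow> 0 \<le> f y" "y \<in> set_pmf p" "0 < f y"
  shows "0 < (\<Sum>y\<in>Y. pmf p y * f y)"
  using assms by (intro sum_pos2[of _ y]) (auto simp: pmf_positive)

section \<open>Operators given as maxima over finitely many generators\<close>

text \<open>Naming the generating sets lets every value of \<open>T\<close> be realised as an
  average under some \<open>p\<close> in \<open>P x\<close>. The set \<open>Y\<close> may be empty,
  so the stages after the end of the decomposition are covered too.\<close>

locale generated_operator =
  fixes Y :: "'a set" and T :: "'a operator" and P :: "'a \<Rightarrow> 'a pmf set"
  assumes finite_Y: "finite Y"
    and finite_P: "x \<in> Y \<Longrightarrow> finite (P x)"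
    and P_nonempty: "x \<in> Y \<Longrightarrow> P x \<noteq> {}"
    and set_P: "x \<in> Y \<Longrightarrow> p \<in> P x \<Longrightarrow> set_pmf p \<subseteq> Y"
    and T_eq: "x \<in> Y \<Longrightarrow> T f x = Max ((\<lambda>p. \<Sum>y\<in>Y. pmf p y * f y) ` P x)"

lemma finitely_generated_imp_generated_operator:
  assumes "finite Y" "finitely_generated Y T"
  obtains P where "generated_operator Y T P"
proof -
  obtain P where "\<forall>x\<in>Y. finite (P x) \<and> P x \<noteq> {} \<and> (\<forall>p\<in>P x. set_pmf p \<subseteq> Y)"
    and "\<forall>f. \<forall>x\<in>Y. T f x = Max ((\<lambda>p. \<Sum>y\<in>Y. pmf p y * f y) ` P x)"
    using assms(2) unfolding finitely_generated_def by blast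
  then have "generated_operator Y T P"
    using assms(1) by (simp add: generated_operator_def)
  then show ?thesis by (rule that)
qed

context generated_operator
begin

lemma T_ge: "x \<in> Y \<Longrightarrow> p \<in> P x \<Longrightarrow> (\<Sum>y\<in>Y. pmf p y * f y) \<le> T f x"
  by (simp add: T_eq finite_P)

lemma T_attained:
  assumes "x \<in> Y"
  obtains p where "p \<in> P x" "T f x = (\<Sum>y\<in>Y. pmf p y * f y)"
proof -
  have "T f x \<in> (\<lambda>p. \<Sum>y\<in>Y. pmf p y * f y) ` P x"
    unfolding T_eq[OF assms] using assms by (intro Max_in) (simp_all add: finite_P P_nonempty)
  then show ?thesis using that by blast
qed

lemma lower_le:
  "x \<in> Y \<Longrightarrow> p \<in> P x \<Longrightarrow> lower_operator T f x \<le> (\<Sum>y\<in>Y. pmf p y * f y)"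
  using T_ge[of x p "\<lambda>y. - f y"] by (simp add: lower_operator_def sum_negf)

lemma lower_attained:
  assumes "x \<in> Y"
  obtains p where "p \<in> P x" "lower_operator T f x = (\<Sum>y\<in>Y. pmf p y * f y)"
proof -
  obtain p where "p \<in> P x" "T (\<lambda>y. - f y) x = (\<Sum>y\<in>Y. pmf p y * - f y)"
    using T_attained[OF assms] by blast
  then show ?thesis using that by (simp add: lower_operator_def sum_negf)
qed

lemma lower_mono:
  assumes "x \<in> Y" "\<And>y. y \<in> Y \<Longrightarrow> f y \<le> g y"
  shows "lower_operator T f x \<le> lower_operator T g x"
proof -
  obtain p where p: "p \<in> P x" "lower_operator T g x = (\<Sum>y\<in>Y. pmf p y * g y)"
    using lower_attained[OF assms(1)] by blast
  have "(\<Sum>y\<in>Y. pmf p y * f y) \<le> (\<Sum>y\<in>Y. pmf p y * g y)"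
    by (intro sum_mono mult_left_mono assms(2)) auto
  then show ?thesis using lower_le[OF assms(1) p(1), of f] p(2) by linarith
qed

lemma T_const_on:
  assumes "x \<in> Y" "\<And>p y. p \<in> P x \<Longrightarrow> y \<in> set_pmf p \<Longrightarrow> f y = c"
  shows "T f x = c"
proof -
  obtain p where p: "p \<in> P x" "T f x = (\<Sum>y\<in>Y. pmf p y * f y)"
    using T_attained[OF assms(1)] by blast
  have "(\<Sum>y\<in>Y. pmf p y * f y) = (\<Sum>y\<in>Y. pmf p y * c)"
    using assms(2)[OF p(1)] by (rule sum_pmf_mult_cong)
  then show ?thesis
    using p sum_pmf_mult_const[OF finite_Y set_P[OF assms(1) p(1)]] by simp
qed

lemma iterate_ge_const:
  assumes "\<And>y. y \<in> Y \<Longrightarrow> c \<le> f y" "x \<in> Y"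
  shows "c \<le> (T ^^ n) f x"
  using assms(2)
proof (induction n arbitrary: x)
  case 0
  then show ?case using assms(1) by simp
next
  case (Suc n)
  obtain p where p: "p \<in> P x" using P_nonempty[OF Suc.prems] by blast
  have "c = (\<Sum>y\<in>Y. pmf p y * c)"
    using sum_pmf_mult_const[OF finite_Y set_P[OF Suc.prems p]] by simp
  also have "\<dots> \<le> (\<Sum>y\<in>Y. pmf p y * (T ^^ n) f y)"
    by (intro sum_mono mult_left_mono Suc.IH) auto
  also have "\<dots> \<le> T ((T ^^ n) f) x" using Suc.prems p by (rule T_ge)
  finally show ?case by simp
qed

section \<open>Accessibility and maximal classes in terms of generators\<close>

text \<open>The value of \<open>T (indicator {y})\<close> at \<open>x\<close> is the largest
  \<open>pmf p y\<close> over the generators at \<open>x\<close>, so it is positive exactly when one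
  of them charges \<open>y\<close>.\<close>

lemma accessibility_graph_iff:
  "(x, y) \<in> accessibility_graph Y T \<longleftrightarrow> x \<in> Y \<and> (\<exists>p\<in>P x. y \<in> set_pmf p)"
proof (cases "x \<in> Y \<and> y \<in> Y")
  case True
  then have x: "x \<in> Y" and y: "y \<in> Y" by auto
  have sum: "(\<Sum>z\<in>Y. pmf p z * indicator {y} z) = pmf p y" for p
  proof -
    have "(\<Sum>z\<in>Y. pmf p z * indicator {y} z) = (\<Sum>z\<in>Y. if y = z then pmf p z else 0)"
      by (intro sum.cong) auto
    then show ?thesis using finite_Y y by simp
  qed
  have "T (indicator {y}) x > 0 \<longleftrightarrow> (\<exists>p\<in>P x. pmf p y > 0)"
    using T_ge[OF x, of _ "indicator {y}"] T_attained[OF x, of "indicator {y}"]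
    unfolding sum by (metis less_le_trans)
  then show ?thesis
    using x y by (auto simp: accessibility_graph_def set_pmf_iff less_le)
next
  case False
  then show ?thesis using set_P by (auto simp: accessibility_graph_def)
qed

lemma maximal_class_subset: "C \<in> maximal_classes Y T \<Longrightarrow> C \<subseteq> Y"
  unfolding maximal_classes_def communication_classes_def
  by (auto simp: quotient_def communication_relation_def)

lemma maximal_class_nonempty: "C \<in> maximal_classes Y T \<Longrightarrow> C \<noteq> {}"
  unfolding maximal_classes_def communication_classes_def
  by (auto simp: quotient_def communication_relation_def accessible_def)

lemma maximal_class_accessible:
  assumes "C \<in> maximal_classes Y T" "x \<in> C" "y \<in> C"
  shows "(x, y) \<in> (accessibility_graph Y T)\<^sup>*"
  using assms unfolding maximal_classes_def communication_classes_def
  by (auto simp: quotient_def communication_relation_def accessible_def intro: rtrancl_trans)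

lemma maximal_class_closed:
  assumes "C \<in> maximal_classes Y T" "x \<in> C" "(x, y) \<in> accessibility_graph Y T"
  shows "y \<in> C"
  using assms by (auto simp: maximal_classes_def accessible_def accessibility_graph_def)

lemma maximal_class_set_P:
  assumes "C \<in> maximal_classes Y T" "x \<in> C" "p \<in> P x"
  shows "set_pmf p \<subseteq> C"
  using maximal_class_closed[OF assms(1,2)] maximal_class_subset[OF assms(1)] assms(2,3)
  by (auto simp: accessibility_graph_iff)

text \<open>No edge leads out of a maximal class, so a path that starts in it never leaves it.
  \<open>regular_class\<close> counts only cycles inside the class.\<close>

lemma maximal_class_path_inside:
  assumes "C \<in> maximal_classes Y T" "x \<in> C" "y \<in> C"
  shows "(x, y) \<in> (accessibility_graph Y T \<inter> C \<times> C)\<^sup>*"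
proof -
  have "(x, z) \<in> (accessibility_graph Y T \<inter> C \<times> C)\<^sup>* \<and> z \<in> C"
    if "(x, z) \<in> (accessibility_graph Y T)\<^sup>*" for z
    using that
  proof (induction rule: rtrancl_induct)
    case base
    then show ?case using assms(2) by simp
  next
    case (step y z)
    then show ?case using maximal_class_closed[OF assms(1)] by (auto intro: rtrancl_into_rtrancl)
  qed
  then show ?thesis using maximal_class_accessible[OF assms] by blast
qed

section \<open>Convergence rules out periodic maximal classes\<close>

lemma regular_class_if_convergent:
  assumes conv: "convergent_operator Y T" and C: "C \<in> maximal_classes Y T"
  shows "regular_class Y T C"
proof -
  define R where "R = accessibility_graph Y T \<inter> C \<times> C"
  define L where "L = {n::nat. n \<ge> 1 \<and> (\<exists>x\<in>C. (x, x) \<in> R ^^ n)}"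
  define D where "D = Gcd L"
  note CY = subsetD[OF maximal_class_subset[OF C]]
  have path: "\<exists>n. (x, y) \<in> R ^^ n" if "x \<in> C" "y \<in> C" for x y
    using maximal_class_path_inside[OF C that] by (simp add: R_def rtrancl_power)
  obtain x0 where x0: "x0 \<in> C" using maximal_class_nonempty[OF C] by blast
  have in_C: "y \<in> C" if "(x0, y) \<in> R ^^ n" for n y
    using that x0 by (cases n) (auto simp: R_def)
  have cycle: "D dvd n" if "(x0, x0) \<in> R ^^ n" for n
  proof (cases "n = 0")
    case False
    then have "n \<in> L" using that x0 by (auto simp: L_def)
    then show ?thesis by (simp add: D_def)
  qed simp
  \<comment> \<open>Closing two paths to \<open>y\<close> by the same return path gives two cycles
    at \<open>x0\<close>; hence divisibility of the length by \<open>D\<close> does not depend on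
    the path chosen.\<close>
  have cong: "D dvd k \<longleftrightarrow> D dvd n" if k: "(x0, y) \<in> R ^^ k" and n: "(x0, y) \<in> R ^^ n" for k n y
  proof -
    obtain m where m: "(y, x0) \<in> R ^^ m" using path[OF in_C[OF k] x0] by blast
    have "D dvd k + m" "D dvd n + m"
      using k n m by (auto intro!: cycle simp: relpow_add)
    then show ?thesis by (metis dvd_add_right_iff add.commute)
  qed
  \<comment> \<open>\<open>Gcd\<close> of the empty set is 0, so some cycle must be exhibited: step
    to a state charged by a generator at \<open>x0\<close> and return inside
    \<open>C\<close>.\<close>
  obtain p y where py: "p \<in> P x0" "y \<in> set_pmf p"
    using P_nonempty[OF CY[OF x0]] by (metis ex_in_conv set_pmf_not_empty)
  have y: "(x0, y) \<in> R" "y \<in> C"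
    using py x0 CY maximal_class_set_P[OF C x0 py(1)] by (auto simp: R_def accessibility_graph_iff)
  obtain m where "(y, x0) \<in> R ^^ m" using path[OF y(2) x0] by blast
  then have "(x0, x0) \<in> R ^^ Suc m" using y(1) by (rule relpow_Suc_I2[rotated])
  then have "Suc m \<in> L" using x0 unfolding L_def by auto
  then have "D dvd Suc m" by (simp add: D_def)
  then have D_pos: "D > 0" by (cases "D = 0") auto
  define A where "A = {y. \<exists>n. (x0, y) \<in> R ^^ n \<and> D dvd n}"
  \<comment> \<open>The length \<open>k\<close> of a path to \<open>y\<close> records the phase of
    \<open>y\<close>; every generator at \<open>y\<close> advances it by one. Only
    \<open>y = x0\<close> with \<open>k = 0\<close> is used afterwards.\<close>
  have iterate: "(T ^^ n) (indicator A) y = of_bool (D dvd k + n)" if "(x0, y) \<in> R ^^ k" for n k y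
    using that
  proof (induction n arbitrary: k y)
    case 0
    then have "y \<in> A \<longleftrightarrow> D dvd k" unfolding A_def using cong[OF 0] by blast
    then show ?case by (simp add: indicator_def)
  next
    case (Suc n)
    have yC: "y \<in> C" using Suc.prems by (rule in_C)
    have "T ((T ^^ n) (indicator A)) y = of_bool (D dvd Suc k + n)"
    proof (rule T_const_on)
      show "y \<in> Y" using yC by (rule CY)
      fix p z assume "p \<in> P y" "z \<in> set_pmf p"
      then have "(y, z) \<in> R"
        using yC CY maximal_class_set_P[OF C yC] by (auto simp: R_def accessibility_graph_iff)
      then have "(x0, z) \<in> R ^^ Suc k" using Suc.prems by auto
      then show "(T ^^ n) (indicator A) z = of_bool (D dvd Suc k + n)" by (rule Suc.IH)
    qed
    then show ?case by simp
  qed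
  have "convergent (\<lambda>n. (T ^^ n) (indicator A) x0)"
    using conv CY[OF x0] by (auto simp: convergent_operator_def)
  moreover have "(T ^^ n) (indicator A) x0 = of_bool (D dvd n)" for n
    using iterate[of x0 0 n] by simp
  ultimately obtain l where l: "(\<lambda>n. of_bool (D dvd n) :: real) \<longlonglongrightarrow> l"
    by (auto simp: convergent_def)
  \<comment> \<open>Along \<open>D * n\<close> the sequence is constantly 1, and along
    \<open>D * n + 1\<close> it is constantly 0 unless \<open>D\<close> divides 1; both subsequences
    share the limit \<open>l\<close>.\<close>
  have sub: "strict_mono (\<lambda>n. D * n)" "strict_mono (\<lambda>n. D * n + 1)"
    using D_pos by (auto simp: strict_mono_def)
  have "l = 1"
    using LIMSEQ_subseq_LIMSEQ[OF l sub(1)] by (simp add: o_def LIMSEQ_const_iff)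
  have "D dvd 1"
  proof (rule ccontr)
    assume "\<not> D dvd 1"
    then have "\<not> D dvd D * n + 1" for n by (metis dvd_add_right_iff dvd_triv_left)
    then have "l = 0"
      using LIMSEQ_subseq_LIMSEQ[OF l sub(2)] by (simp add: o_def LIMSEQ_const_iff)
    then show False using \<open>l = 1\<close> by simp
  qed
  then show ?thesis using C by (simp add: regular_class_def D_def L_def R_def)
qed

section \<open>Generators of the restricted operator\<close>

text \<open>
  The bound on the restricted credal set comes from testing its members against
  \<open>g - K 1\<^bsub>Y - Y'\<^esub>\<close>: for large \<open>K\<close> no generator that leaves \<open>Y'\<close> attains the maximum.
\<close>

lemma restricted_operator_generated:
  assumes sub: "Y' \<subseteq> Y" and stay: "\<And>x. x \<in> Y' \<Longrightarrow> \<exists>p\<in>P x. set_pmf p \<subseteq> Y'"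
  shows "generated_operator Y' (restricted_operator Y T Y') (\<lambda>x. {p \<in> P x. set_pmf p \<subseteq> Y'})"
proof
  show "finite Y'" using finite_Y sub by (rule finite_subset[rotated])
  fix x assume x': "x \<in> Y'"
  then have x: "x \<in> Y" using sub by blast
  let ?P' = "{p \<in> P x. set_pmf p \<subseteq> Y'}"
  show fin: "finite ?P'" using finite_P[OF x] by simp
  show ne: "?P' \<noteq> {}" using stay[OF x'] by blast
  show "set_pmf p \<subseteq> Y'" if "p \<in> ?P'" for p using that by blast
  fix g
  define M where "M = Max ((\<lambda>p. \<Sum>y\<in>Y'. pmf p y * g y) ` ?P')"
  have M_ge: "(\<Sum>y\<in>Y'. pmf p y * g y) \<le> M" if "p \<in> ?P'" for p
    using fin that by (simp add: M_def)
  have M_in: "M \<in> (\<lambda>p. \<Sum>y\<in>Y'. pmf p y * g y) ` ?P'"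
    unfolding M_def using fin ne by (intro Max_in) auto
  have restricted: "set_pmf q \<subseteq> Y'" if "q \<in> restricted_credal_set Y T Y' x" for q
    using that by (auto simp: restricted_credal_set_def credal_set_def set_pmf_iff)
  have upper: "(\<Sum>y\<in>Y'. pmf q y * g y) \<le> M" if q: "q \<in> restricted_credal_set Y T Y' x" for q
  proof -
    define c where "c = (\<Sum>y\<in>Y. \<bar>g y\<bar>)"
    have g_le: "g y \<le> c" if "y \<in> Y" for y
      using member_le_sum[OF that, of "\<lambda>y. \<bar>g y\<bar>"] finite_Y by (simp add: c_def)
    \<comment> \<open>The mass that \<open>p\<close> puts outside \<open>Y'\<close>, which is what
      the penalty charges for.\<close>
    define leak where "leak p = (\<Sum>y\<in>Y. pmf p y * indicator (Y - Y') y)" for p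
    have leak_pos: "0 < leak p" if p: "p \<in> P x - ?P'" for p
    proof -
      obtain y where "y \<in> set_pmf p" "y \<notin> Y'" using p by blast
      then show ?thesis
        unfolding leak_def using set_P[OF x, of p] p
        by (intro sum_pmf_mult_pos[OF finite_Y]) auto
    qed
    \<comment> \<open>A leaking generator averages \<open>g\<close> to at most \<open>c\<close>;
      with this \<open>K\<close> the penalty pushes it down to at most \<open>M\<close>.\<close>
    have "\<exists>K\<ge>0. \<forall>p\<in>P x - ?P'. c - M \<le> K * leak p"
      using finite_P[OF x] by (intro finite_uniform_multiplier leak_pos) auto
    then obtain K where K: "\<And>p. p \<in> P x - ?P' \<Longrightarrow> c - M \<le> K * leak p" by blast
    let ?f = "\<lambda>y. g y - K * indicator (Y - Y') y"
    have restrict: "(\<Sum>y\<in>Y. pmf p y * ?f y) = (\<Sum>y\<in>Y'. pmf p y * g y)"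
      if "set_pmf p \<subseteq> Y'" for p
      unfolding sum_pmf_mult_mono_set[OF finite_Y sub that] using that
      by (intro sum.cong) (auto simp: indicator_def)
    have "(\<Sum>y\<in>Y. pmf q y * ?f y) \<le> T ?f x"
      using q by (auto simp: restricted_credal_set_def credal_set_def)
    also have "T ?f x \<le> M"
    proof -
      obtain p where p: "p \<in> P x" and Tp: "T ?f x = (\<Sum>y\<in>Y. pmf p y * ?f y)"
        using T_attained[OF x] by blast
      show ?thesis
      proof (cases "set_pmf p \<subseteq> Y'")
        case True
        then show ?thesis using M_ge[of p] p Tp restrict[OF True] by simp
      next
        case False
        have "T ?f x = (\<Sum>y\<in>Y. pmf p y * g y) - K * leak p"
          unfolding Tp leak_def by (simp add: algebra_simps sum_subtractf sum_distrib_left)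
        moreover have "(\<Sum>y\<in>Y. pmf p y * g y) \<le> (\<Sum>y\<in>Y. pmf p y * c)"
          by (intro sum_mono mult_left_mono g_le) auto
        moreover have "(\<Sum>y\<in>Y. pmf p y * c) = c"
          using finite_Y set_P[OF x p] by (rule sum_pmf_mult_const)
        moreover have "c - M \<le> K * leak p" using K[of p] p False by simp
        ultimately show ?thesis by linarith
      qed
    qed
    finally show ?thesis using restrict[OF restricted[OF q]] by simp
  qed
  \<comment> \<open>Generators that stay belong to the restricted credal set, so the upper bound
    \<open>M\<close> is also attained there and the supremum is a maximum.\<close>
  have "?P' \<subseteq> restricted_credal_set Y T Y' x"
    using T_ge[OF x] sub by (auto simp: restricted_credal_set_def credal_set_def set_pmf_iff)
  then have "M \<in> (\<lambda>q. \<Sum>y\<in>Y'. pmf q y * g y) ` restricted_credal_set Y T Y' x"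
    using M_in by blast
  then show "restricted_operator Y T Y' g x = Max ((\<lambda>p. \<Sum>y\<in>Y'. pmf p y * g y) ` ?P')"
    unfolding restricted_operator_def M_def[symmetric]
    using upper by (intro cSup_eq_maximum) auto
qed

section \<open>Lower iterates and a barrier function for the remaining states\<close>

lemma lower_iterate_nonneg:
  "x \<in> Y \<Longrightarrow> 0 \<le> (lower_operator T ^^ n) (indicator M) x"
proof (induction n arbitrary: x)
  case (Suc n)
  obtain p where "lower_operator T ((lower_operator T ^^ n) (indicator M)) x =
      (\<Sum>y\<in>Y. pmf p y * (lower_operator T ^^ n) (indicator M) y)"
    using lower_attained[OF Suc.prems] by blast
  then show ?case using Suc.IH by (simp add: sum_nonneg)
qed simp

text \<open>Mass in \<open>M\<close> stays in \<open>M\<close>, so the first application of the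
  lower operator does not decrease the indicator; monotonicity of the operator carries this to all
  later iterates.\<close>

lemma lower_iterate_mono:
  assumes closed: "\<And>x p. x \<in> M \<Longrightarrow> x \<in> Y \<Longrightarrow> p \<in> P x \<Longrightarrow> set_pmf p \<subseteq> M"
    and "x \<in> Y" "m \<le> n"
  shows "(lower_operator T ^^ m) (indicator M) x \<le> (lower_operator T ^^ n) (indicator M) x"
proof -
  have "(lower_operator T ^^ n) (indicator M) x \<le> (lower_operator T ^^ Suc n) (indicator M) x"
    if "x \<in> Y" for n x
    using that
  proof (induction n arbitrary: x)
    case 0
    obtain p where p: "p \<in> P x"
      and eq: "lower_operator T (indicator M) x = (\<Sum>y\<in>Y. pmf p y * indicator M y)"
      using lower_attained[OF 0] by blast
    show ?case
    proof (cases "x \<in> M")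
      case True
      have "(\<Sum>y\<in>Y. pmf p y * indicator M y) = (\<Sum>y\<in>Y. pmf p y * (1::real))"
        using closed[OF True 0 p] by (intro sum_pmf_mult_cong) auto
      also have "\<dots> = 1" using finite_Y set_P[OF 0 p] by (rule sum_pmf_mult_const)
      finally show ?thesis using eq by simp
    next
      case False
      then show ?thesis using lower_iterate_nonneg[OF 0, of 1] by simp
    qed
  next
    case (Suc n)
    then show ?case using lower_mono[OF Suc.prems] by simp
  qed
  from this[OF assms(2)] assms(3) show ?thesis
    by (rule lift_Suc_mono_le[where f = "\<lambda>n. (lower_operator T ^^ n) (indicator M) x"])
qed

text \<open>The lower iterates increase, so a state outside \<open>Y'\<close> that becomes positive
  stays positive, and finiteness of \<open>Y\<close> gives one iterate positive at all of them. The
  inequality \<open>w x \<le> lower_operator T w x\<close> is again the monotonicity in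
  \<open>n\<close>.\<close>

lemma remaining_states_barrier:
  defines "Y' \<equiv> remaining_states Y T"
  obtains w where "\<And>x. x \<in> Y \<Longrightarrow> 0 \<le> w x" "\<And>x. x \<in> Y - Y' \<Longrightarrow> 0 < w x" "\<And>x. x \<in> Y' \<Longrightarrow> w x = 0"
    "\<And>x. x \<in> Y \<Longrightarrow> w x \<le> lower_operator T w x" "\<And>x. x \<in> Y' \<Longrightarrow> lower_operator T w x = 0"
proof -
  define M where "M = \<Union>(maximal_classes Y T)"
  define w where "w n = (lower_operator T ^^ n) (indicator M)" for n
  have closed: "set_pmf p \<subseteq> M" if "x \<in> M" "p \<in> P x" for x p
    using that maximal_class_set_P unfolding M_def by blast
  have mono: "w m x \<le> w n x" if "x \<in> Y" "m \<le> n" for m n x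
    unfolding w_def using closed that by (intro lower_iterate_mono) auto
  \<comment> \<open>\<open>lower_reachable\<close> speaks only of positive exponents, so index
    \<open>n\<close> is reached through \<open>Suc n\<close> and monotonicity.\<close>
  have zero: "w n x = 0" if "x \<in> Y'" for n x
  proof -
    have "x \<in> Y" "\<not> 0 < w (Suc n) x"
      using that unfolding Y'_def remaining_states_def lower_reachable_def w_def M_def by force+
    then show ?thesis
      using mono[of x n "Suc n"] lower_iterate_nonneg[of x n M] unfolding w_def by fastforce
  qed
  have ex_pos: "\<exists>n. 0 < w n x" if "x \<in> Y - Y'" for x
  proof (cases "x \<in> M")
    case True
    then have "0 < w 0 x" by (simp add: w_def)
    then show ?thesis by blast
  next
    case False
    then have "lower_reachable T M x"
      using that by (simp add: Y'_def remaining_states_def M_def)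
    then show ?thesis by (auto simp: lower_reachable_def w_def)
  qed
  have "\<forall>\<^sub>F n in sequentially. 0 < w n x" if x: "x \<in> Y - Y'" for x
  proof -
    obtain m where "0 < w m x" using ex_pos[OF x] by blast
    then have "0 < w n x" if "m \<le> n" for n using mono[of x m n] x that by simp
    then show ?thesis by (auto simp: eventually_sequentially)
  qed
  then have "\<forall>\<^sub>F n in sequentially. \<forall>x\<in>Y - Y'. 0 < w n x"
    using finite_Y by (intro eventually_ball_finite) auto
  then obtain n where n: "\<And>x. x \<in> Y - Y' \<Longrightarrow> 0 < w n x"
    by (auto simp: eventually_sequentially)
  have w_Suc: "lower_operator T (w n) = w (Suc n)" by (simp add: w_def)
  show ?thesis
  proof (rule that[of "w n"])
    show "0 \<le> w n x" if "x \<in> Y" for x unfolding w_def using that by (rule lower_iterate_nonneg)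
  qed (use n mono zero w_Suc in auto)
qed

text \<open>A generator attaining the lower value 0 averages a nonnegative function that is positive
  off the remaining states, so it cannot charge any state outside them. This makes the restricted
  operator well defined.\<close>

lemma remaining_states_stay:
  assumes "x \<in> remaining_states Y T"
  shows "\<exists>p\<in>P x. set_pmf p \<subseteq> remaining_states Y T"
proof -
  obtain w where w: "\<And>x. x \<in> Y \<Longrightarrow> 0 \<le> w x" "\<And>x. x \<in> Y - remaining_states Y T \<Longrightarrow> 0 < w x"
    "\<And>x. x \<in> remaining_states Y T \<Longrightarrow> lower_operator T w x = 0"
    using remaining_states_barrier by metis
  have x: "x \<in> Y" using assms by (simp add: remaining_states_def)
  obtain p where p: "p \<in> P x" and "lower_operator T w x = (\<Sum>y\<in>Y. pmf p y * w y)"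
    using lower_attained[OF x] by blast
  then have sum: "(\<Sum>y\<in>Y. pmf p y * w y) = 0" using w(3)[OF assms] by simp
  have "y \<in> remaining_states Y T" if y: "y \<in> set_pmf p" for y
  proof (rule ccontr)
    assume "y \<notin> remaining_states Y T"
    then have "0 < w y" using w(2) set_P[OF x p] y by blast
    then show False
      using sum_pmf_mult_pos[OF finite_Y set_P[OF x p], of w y] w(1) y sum by simp
  qed
  then show ?thesis using p by blast
qed

section \<open>Inheritance of convergence through a penalised start function\<close>

lemma remaining_states_convergent:
  assumes conv: "convergent_operator Y T"
  shows "convergent_operator (remaining_states Y T) (restricted_operator Y T (remaining_states Y T))"
proof -
  define Y' where "Y' = remaining_states Y T"
  define S where "S = restricted_operator Y T Y'"
  define P' where "P' x = {p \<in> P x. set_pmf p \<subseteq> Y'}" for x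
  have sub: "Y' \<subseteq> Y" by (auto simp: Y'_def remaining_states_def)
  interpret S: generated_operator Y' S P'
    unfolding S_def P'_def using sub remaining_states_stay[folded Y'_def]
    by (rule restricted_operator_generated)
  obtain w where w_nonneg: "\<And>x. x \<in> Y \<Longrightarrow> 0 \<le> w x" and w_pos: "\<And>x. x \<in> Y - Y' \<Longrightarrow> 0 < w x"
    and w_zero: "\<And>x. x \<in> Y' \<Longrightarrow> w x = 0"
    and w_lower: "\<And>x. x \<in> Y \<Longrightarrow> w x \<le> lower_operator T w x"
    unfolding Y'_def using remaining_states_barrier by metis
  have "convergent (\<lambda>n. (S ^^ n) g x)" if x: "x \<in> Y'" for g x
  proof -
    define c where "c = (\<Sum>y\<in>Y. \<bar>g y\<bar>)"
    have g_le: "\<bar>g y\<bar> \<le> c" if "y \<in> Y" for y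
      using member_le_sum[OF that, of "\<lambda>y. \<bar>g y\<bar>"] finite_Y by (simp add: c_def)
    define cost where "cost p = (\<Sum>y\<in>Y. pmf p y * w y)" for p
    have cost_pos: "0 < cost p" if p: "p \<in> (\<Union>x\<in>Y'. P x - P' x)" for p
    proof -
      obtain x y where xy: "x \<in> Y'" "p \<in> P x" "y \<in> set_pmf p" "y \<notin> Y'"
        using p by (auto simp: P'_def)
      then have pY: "set_pmf p \<subseteq> Y" using sub set_P by blast
      then have "0 < w y" using w_pos xy by blast
      then show ?thesis
        unfolding cost_def using sum_pmf_mult_pos[OF finite_Y pY, of w y] w_nonneg xy(3) by blast
    qed
    have "finite (\<Union>x\<in>Y'. P x - P' x)" using S.finite_Y finite_P sub by auto
    \<comment> \<open>The factor 2 brings a leaving generator from the bound \<open>c\<close> down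
      to \<open>- c\<close>, which bounds the iterates of \<open>S\<close> from below.\<close>
    then have "\<exists>K\<ge>0. \<forall>p\<in>(\<Union>x\<in>Y'. P x - P' x). 2 * c \<le> K * cost p"
      using cost_pos by (rule finite_uniform_multiplier)
    then obtain K where "0 \<le> K" and K: "\<And>x p. x \<in> Y' \<Longrightarrow> p \<in> P x - P' x \<Longrightarrow> 2 * c \<le> K * cost p"
      by blast
    define V where "V n = (T ^^ n) (\<lambda>y. g y - K * w y)" for n
    have V_Suc: "V (Suc n) = T (V n)" for n by (simp add: V_def)
    have step: "(\<Sum>y\<in>Y. pmf p y * V n y) \<le> c - K * cost p"
      if V: "\<And>y. y \<in> Y \<Longrightarrow> V n y \<le> c - K * w y" and p: "set_pmf p \<subseteq> Y" for n p
    proof -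
      have "(\<Sum>y\<in>Y. pmf p y * V n y) \<le> (\<Sum>y\<in>Y. pmf p y * (c - K * w y))"
        by (intro sum_mono mult_left_mono V) auto
      also have "\<dots> = (\<Sum>y\<in>Y. pmf p y * c) - K * cost p"
        by (simp add: cost_def algebra_simps sum_subtractf sum_distrib_left)
      finally show ?thesis using sum_pmf_mult_const[OF finite_Y p] by simp
    qed
    \<comment> \<open>The bound is preserved by \<open>T\<close>: every generator at
      \<open>y\<close> has cost at least \<open>lower_operator T w y\<close>, hence at least
      \<open>w y\<close>, and \<open>K\<close> is nonnegative.\<close>
    have V_le: "V n y \<le> c - K * w y" if "y \<in> Y" for n y
      using that
    proof (induction n arbitrary: y)
      case 0
      then show ?case using g_le[OF 0] by (simp add: V_def)
    next
      case (Suc n)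
      obtain p where p: "p \<in> P y" "T (V n) y = (\<Sum>z\<in>Y. pmf p z * V n z)"
        using T_attained[OF Suc.prems] by blast
      have "T (V n) y \<le> c - K * cost p"
        unfolding p(2) using Suc.IH set_P[OF Suc.prems p(1)] by (rule step)
      moreover have "w y \<le> cost p"
        using w_lower[OF Suc.prems] lower_le[OF Suc.prems p(1), of w] by (simp add: cost_def)
      then have "K * w y \<le> K * cost p" using \<open>0 \<le> K\<close> by (rule mult_left_mono)
      ultimately show ?case by (simp add: V_Suc)
    qed
    have S_ge: "- c \<le> (S ^^ n) g y" if "y \<in> Y'" for n y
    proof (rule S.iterate_ge_const)
      show "- c \<le> g z" if "z \<in> Y'" for z using g_le[of z] that sub by force
    qed (rule that)
    have "V n y = (S ^^ n) g y" if "y \<in> Y'" for n y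
      using that
    proof (induction n arbitrary: y)
      case 0
      then show ?case by (simp add: V_def w_zero)
    next
      case (Suc n)
      then have y: "y \<in> Y" using sub by blast
      have eq: "(\<Sum>z\<in>Y. pmf p z * V n z) = (\<Sum>z\<in>Y'. pmf p z * (S ^^ n) g z)" if "p \<in> P' y" for p
        using sum_pmf_mult_mono_set[OF finite_Y sub] Suc.IH that by (simp add: P'_def)
      have "T (V n) y = S ((S ^^ n) g) y"
      \<comment> \<open>A generator that stays sees \<open>V n\<close> only on \<open>Y'\<close>,
        where the induction hypothesis applies; one that leaves gives at most \<open>- c\<close> and
        cannot exceed the value of \<open>S\<close>.\<close>
      proof (rule antisym)
        obtain p where p: "p \<in> P y" "T (V n) y = (\<Sum>z\<in>Y. pmf p z * V n z)"
          using T_attained[OF y] by blast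
        show "T (V n) y \<le> S ((S ^^ n) g) y"
        proof (cases "p \<in> P' y")
          case True
          then show ?thesis using S.T_ge[OF Suc.prems True] eq p(2) by simp
        next
          case False
          have "T (V n) y \<le> c - K * cost p"
            unfolding p(2) using V_le set_P[OF y p(1)] by (rule step)
          also have "\<dots> \<le> - c" using K[of y p] Suc.prems p(1) False by simp
          also have "\<dots> \<le> S ((S ^^ n) g) y" using S_ge[OF Suc.prems, of "Suc n"] by simp
          finally show ?thesis .
        qed
        obtain p where p: "p \<in> P' y" "S ((S ^^ n) g) y = (\<Sum>z\<in>Y'. pmf p z * (S ^^ n) g z)"
          using S.T_attained[OF Suc.prems] by blast
        then show "S ((S ^^ n) g) y \<le> T (V n) y"
          using T_ge[OF y, of p "V n"] eq[OF p(1)] by (simp add: P'_def)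
      qed
      then show ?case by (simp add: V_Suc)
    qed
    moreover have "convergent (\<lambda>n. V n x)"
      using conv x sub by (auto simp: convergent_operator_def V_def)
    ultimately show ?thesis using x by simp
  qed
  then show ?thesis by (simp add: convergent_operator_def S_def Y'_def)
qed

lemma remaining_states_generated:
  "\<exists>P'. generated_operator (remaining_states Y T) (restricted_operator Y T (remaining_states Y T)) P'"
  using restricted_operator_generated[OF _ remaining_states_stay]
  by (auto simp: remaining_states_def)

end

section \<open>Induction over the stages of the decomposition\<close>

text \<open>Both properties pass from a stage to the next and hold vacuously on an empty one, so the
  induction runs over all \<open>l\<close> without reference to the depth.\<close>

lemma stage_generated_convergent:
  assumes "finite X" "finitely_generated X T" "convergent_operator X T"
  shows "(\<exists>P. generated_operator (stage_states X T l) (stage_operator X T l) P) \<and>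
    convergent_operator (stage_states X T l) (stage_operator X T l)"
proof (induction l)
  case 0
  obtain P where "generated_operator X T P"
    using assms(1,2) by (rule finitely_generated_imp_generated_operator)
  then show ?case using assms(3) by (auto simp: stage_states_def stage_operator_def)
next
  case (Suc l)
  then show ?case
    using generated_operator.remaining_states_generated generated_operator.remaining_states_convergent
    by (fastforce simp: stage_states_def stage_operator_def Let_def split: prod.split)
qed

theorem proposition23:
  fixes X :: "'a set" and T :: "('a \<Rightarrow> real) \<Rightarrow> 'a \<Rightarrow> real"
  assumes "finite X" and "X \<noteq> {}"
    and "upper_transition_operator X T"
    and "finitely_generated X T"
    and "convergent_operator X T"
  shows "\<forall>l\<in>{1..decomposition_depth X T}.
           \<forall>C\<in>maximal_classes (stage_states X T (l - 1)) (stage_operator X T (l - 1)).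
             regular_class (stage_states X T (l - 1)) (stage_operator X T (l - 1)) C"
  using stage_generated_convergent[OF assms(1,4,5)] generated_operator.regular_class_if_convergent
  by blast

end
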